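(* Let $X$ be a real Hilbert space and let $f,g\in\Gamma_0(X)$. Let $T:=\operatorname{Id}-\operatorname{P}_f+\operatorname{P}_g\operatorname{R}_f$ and $v:=P_{\overline{\operatorname{ran}}(\operatorname{Id}-T)}(0)$. Assume that $\overline{\operatorname{ran}}(\operatorname{Id}-T)=\overline{D\cap R}=\overline{D}\cap\overline{R}$, where $D:=\operatorname{dom}\partial f-\operatorname{dom}\partial g$ and $R:=\operatorname{ran}\partial f+\operatorname{ran}\partial g$. Suppose that $0\in\operatorname{dom}f^*+\operatorname{dom}g^*$, that $v\in\operatorname{ran}(\operatorname{Id}-T)$, and that $\operatorname{zer}(\partial f+\partial g(\cdot-v))\neq\varnothing$. Set $\mu:=\min_{y\in X}\big(f(y)+g(y-v)\big)$. Let $x\in X$. Then there exists $\overline{z}\in X$ such that: (i) $\operatorname{P}_fT^nx\rightharpoonup\overline{z}$ (weakly) and $\overline{z}$ is a minimizer of $f+g(\cdot-v)$; (ii) $\operatorname{P}_g\operatorname{R}_fT^nx\rightharpoonup\overline{z}-v$ and $\overline{z}-v$ is a minimizer of $f(\cdot+v)+g$; (iii) $f(\operatorname{P}_fT^nx)+g(\operatorname{P}_g\operatorname{R}_fT^nx)\to f(\overline{z})+g(\overline{z}-v)=\mu$; (iv) $f(\operatorname{P}_fT^nx)\to f(\overline{z})$; (v) $g(\operatorname{P}_g\operatorname{R}_fT^nx)\to g(\overline{z}-v)$.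
   Context: $\Gamma_0(X)$ denotes the set of convex, lower semicontinuous, proper functions $X\to\left]-\infty,+\infty\right]$. For $h\in\Gamma_0(X)$, $\operatorname{P}_h:=\operatorname{Prox}_h=(\operatorname{Id}+\partial h)^{-1}$ is the proximal mapping and $\operatorname{R}_h:=2\operatorname{P}_h-\operatorname{Id}$. $f^*$ denotes the Fenchel conjugate. $P_C$ denotes the metric projection onto a nonempty closed convex set $C$; $\overline{\operatorname{ran}}$ denotes the closure of the range. $\operatorname{zer}M=M^{-1}(0)$. $T^n$ is the $n$-th iterate of $T$. *)

theory Defs
  imports "HOL-Analysis.Analysis" "HOL-Library.Extended_Real"
begin

definition ereal_convex :: "('a::real_vector \<Rightarrow> ereal) \<Rightarrow> bool" where
  "ereal_convex f \<longleftrightarrow> (\<forall>x y t. 0 \<le> t \<and> t \<le> 1 \<longrightarrow>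
     f ((1 - t) *\<^sub>R x + t *\<^sub>R y) \<le> ereal (1 - t) * f x + ereal t * f y)"

definition lsc :: "('a::topological_space \<Rightarrow> ereal) \<Rightarrow> bool" where
  "lsc f \<longleftrightarrow> (\<forall>x. f x \<le> Liminf (at x) f)"

definition proper :: "('a \<Rightarrow> ereal) \<Rightarrow> bool" where
  "proper f \<longleftrightarrow> (\<forall>x. f x \<noteq> -\<infinity>) \<and> (\<exists>x. f x \<noteq> \<infinity>)"

definition Gamma0 :: "('a::real_normed_vector \<Rightarrow> ereal) set" where
  "Gamma0 = {f. ereal_convex f \<and> lsc f \<and> proper f}"

definition dom :: "('a \<Rightarrow> ereal) \<Rightarrow> 'a set" where
  "dom f = {x. f x < \<infinity>}"

definition subdiff :: "('a::real_inner \<Rightarrow> ereal) \<Rightarrow> 'a \<Rightarrow> 'a set" where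
  "subdiff f x = {u. f x \<noteq> \<infinity> \<and> f x \<noteq> -\<infinity> \<and>
                      (\<forall>y. f x + ereal (u \<bullet> (y - x)) \<le> f y)}"

definition dom_subdiff :: "('a::real_inner \<Rightarrow> ereal) \<Rightarrow> 'a set" where
  "dom_subdiff f = {x. subdiff f x \<noteq> {}}"

definition ran_subdiff :: "('a::real_inner \<Rightarrow> ereal) \<Rightarrow> 'a set" where
  "ran_subdiff f = (\<Union>x. subdiff f x)"

definition conj :: "('a::real_inner \<Rightarrow> ereal) \<Rightarrow> 'a \<Rightarrow> ereal" where
  "conj f u = (SUP x. ereal (u \<bullet> x) - f x)"

text \<open>Proximal mapping \<open>P\<^sub>f = (Id + \<partial>f)\<^sup>-\<^sup>1\<close> and reflected resolvent \<open>R\<^sub>f = 2P\<^sub>f - Id\<close>.\<close>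
definition prox :: "('a::real_inner \<Rightarrow> ereal) \<Rightarrow> 'a \<Rightarrow> 'a" where
  "prox f x = (THE p. x - p \<in> subdiff f p)"

definition refl :: "('a::real_inner \<Rightarrow> ereal) \<Rightarrow> 'a \<Rightarrow> 'a" where
  "refl f x = 2 *\<^sub>R prox f x - x"

text \<open>Metric projection onto a (nonempty closed convex) set.\<close>
definition proj :: "'a::metric_space set \<Rightarrow> 'a \<Rightarrow> 'a" where
  "proj C a = (THE p. p \<in> C \<and> (\<forall>y\<in>C. dist a p \<le> dist a y))"

definition weak_conv :: "(nat \<Rightarrow> 'a::real_inner) \<Rightarrow> 'a \<Rightarrow> bool" where
  "weak_conv xs z \<longleftrightarrow> (\<forall>y. (\<lambda>n. xs n \<bullet> y) \<longlonglongrightarrow> z \<bullet> y)"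

end

theory Submission
  imports Defs
begin

text \<open>
  For the least norm element \<open>d\<close> of the closure of \<open>dom f - dom g\<close>, the functional
  \<open>\<lambda>y. d \<bullet> y\<close> is bounded above on \<open>dom g\<close>, so
  \<open>dom g*\<close> is stable under adding \<open>d\<close>; hence \<open>d\<close> also lies in the closure of \<open>R\<close>, and \<open>v = d\<close>.
  Therefore \<open>-v\<close> is normal to \<open>dom f\<close> and \<open>v\<close> is normal to \<open>dom g\<close> at every solution \<open>z\<close> of the
  normal problem: if \<open>u\<close> is a multiplier, then \<open>u - n v\<close> is a subgradient of \<open>f\<close> at \<open>z\<close> and
  \<open>-u + (n+1) v\<close> one of \<open>g\<close> at \<open>z - v\<close>. So \<open>z + u - n v\<close> is an orbit of \<open>T\<close> with constant shadow
  \<open>z\<close>, and firm nonexpansiveness makes the distance of \<open>T\<^sup>n x\<close> to it decrease, with summable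
  monotonicity gaps. The gaps control the function values, so that weak cluster points of the shadow
  sequence are solutions, and they also show that inner products of the shadow sequence with differences
  of solutions converge, so that there is only one cluster point.

  Resolvents come from minimising strongly convex functions. Weak compactness is Tychonoff's theorem
  combined with the Riesz representation, itself obtained as a resolvent of a linear functional.
\<close>

section \<open>Lower semicontinuity, finite values and minorants of functions in
  \<open>Gamma0\<close>\<close>

lemma lsc_eventually:
  assumes "lsc f" "y < f x"
  shows "eventually (\<lambda>z. y < f z) (nhds x)"
proof -
  have "y < Liminf (at x) f"
    using assms unfolding lsc_def by (meson less_le_trans)
  then have "eventually (\<lambda>z. y < f z) (at x)"
    by (rule less_LiminfD)
  \<comment> \<open>The filter \<open>at x\<close> omits \<open>x\<close> itself; the second
    assumption supplies that point.\<close>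
  with assms(2) show ?thesis
    by (simp add: eventually_at_filter eventually_mono)
       (smt (verit, best) eventually_mono)
qed

lemma lsc_le_limit:
  assumes "lsc f" "(s \<longlongrightarrow> p) G" "G \<noteq> bot"
    and "((\<lambda>n. f (s n)) \<longlongrightarrow> l) G"
  shows "f p \<le> l"
proof (rule ccontr)
  assume "\<not> f p \<le> l"
  then obtain m where m: "l < m" "m < f p"
    using dense by (metis not_le)
  have "eventually (\<lambda>n. m < f (s n)) G"
    using lsc_eventually[OF assms(1) m(2)] assms(2) unfolding filterlim_iff by blast
  moreover have "eventually (\<lambda>n. f (s n) < m) G"
    using order_tendstoD(2)[OF assms(4) m(1)] .
  ultimately have "eventually (\<lambda>n. False) G"
    by eventually_elim auto
  with assms(3) show False by simp
qed

lemma Gamma0_dom_ereal: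
  assumes "f \<in> Gamma0" "y \<in> dom f"
  shows "f y = ereal (real_of_ereal (f y))"
  using assms unfolding Gamma0_def proper_def dom_def by (cases "f y") auto

lemma Gamma0_dom_cases:
  assumes "f \<in> Gamma0" "y \<in> dom f"
  obtains a where "f y = ereal a"
  using Gamma0_dom_ereal[OF assms] by blast

lemma Gamma0_dom_nonempty:
  assumes "f \<in> Gamma0" obtains x where "x \<in> dom f"
  using assms unfolding Gamma0_def proper_def dom_def by auto

lemma Gamma0_convex_comb:
  assumes f: "f \<in> Gamma0" and xy: "x \<in> dom f" "y \<in> dom f" and t: "0 \<le> t" "t \<le> 1"
  shows "(1 - t) *\<^sub>R x + t *\<^sub>R y \<in> dom f"
    and "real_of_ereal (f ((1 - t) *\<^sub>R x + t *\<^sub>R y))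
      \<le> (1 - t) * real_of_ereal (f x) + t * real_of_ereal (f y)"
proof -
  have le: "f ((1 - t) *\<^sub>R x + t *\<^sub>R y) \<le> ereal (1 - t) * f x + ereal t * f y"
    using f t unfolding Gamma0_def ereal_convex_def by auto
  obtain a b where ab: "f x = ereal a" "f y = ereal b"
    using Gamma0_dom_cases[OF f] xy by meson
  show d: "(1 - t) *\<^sub>R x + t *\<^sub>R y \<in> dom f"
    using le ab unfolding dom_def by auto
  then obtain e where "f ((1 - t) *\<^sub>R x + t *\<^sub>R y) = ereal e"
    using Gamma0_dom_cases[OF f] by blast
  then show "real_of_ereal (f ((1 - t) *\<^sub>R x + t *\<^sub>R y))
      \<le> (1 - t) * real_of_ereal (f x) + t * real_of_ereal (f y)"
    using le ab by simp
qed

lemma convex_dom: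
  assumes "f \<in> Gamma0" shows "convex (dom f)"
  using Gamma0_convex_comb(1)[OF assms] by (auto simp: convex_alt)

text \<open>No separation theorem is needed: lower semicontinuity bounds \<open>f\<close> from below
  on a ball around \<open>x0\<close>, and a value far below the cone at a distant \<open>y\<close>
  would, by convexity, push \<open>f\<close> under that bound inside the ball.\<close>

lemma Gamma0_linear_minorant:
  assumes f: "f \<in> Gamma0"
  obtains a c where "c \<ge> 0" "\<And>y. ereal (a - c * norm y) \<le> f y"
proof -
  obtain x0 where x0: "x0 \<in> dom f" using Gamma0_dom_nonempty f by blast
  define r where "r = real_of_ereal (f x0)"
  have r: "f x0 = ereal r" using Gamma0_dom_ereal[OF f x0] by (simp add: r_def)
  have "ereal (r - 1) < f x0" by (simp add: r)
  then have "eventually (\<lambda>z. ereal (r - 1) < f z) (nhds x0)"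
    using f lsc_eventually unfolding Gamma0_def by blast
  then obtain d where d: "d > 0" "\<And>z. dist z x0 < d \<Longrightarrow> ereal (r - 1) < f z"
    unfolding eventually_nhds_metric by blast
  define e where "e = d / 2"
  have e: "e > 0" "e < d" using d by (auto simp: e_def)
  have main: "ereal (r - 1 - norm (y - x0) / e) \<le> f y" for y
  proof (cases "y \<in> dom f")
    case False
    then show ?thesis by (simp add: dom_def)
  next
    case True
    define b where "b = real_of_ereal (f y)"
    have b: "f y = ereal b" using Gamma0_dom_ereal[OF f True] by (simp add: b_def)
    show ?thesis
    proof (cases "norm (y - x0) \<le> e")
      case True
      then have "ereal (r - 1) < f y" using d(2)[of y] e by (simp add: dist_norm)
      moreover have "norm (y - x0) / e \<ge> 0" using e by simp
      ultimately show ?thesis by (auto simp: b)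
    next
      case False
      define N where "N = norm (y - x0)"
      have N: "N > e" using False by (simp add: N_def)
      \<comment> \<open>This \<open>t\<close> places \<open>z\<close> on the segment from
        \<open>x0\<close> to \<open>y\<close> at distance exactly \<open>e\<close> from
        \<open>x0\<close>, where the local bound \<open>r - 1\<close> holds.\<close>
      define t where "t = e / N"
      have t: "0 < t" "t \<le> 1" "t * N = e" using N e by (auto simp: t_def)
      define z where "z = (1 - t) *\<^sub>R x0 + t *\<^sub>R y"
      have "z - x0 = t *\<^sub>R (y - x0)" by (simp add: z_def algebra_simps)
      then have "dist z x0 = e" using t by (simp add: dist_norm N_def)
      then have "ereal (r - 1) < f z" using d(2) e by simp
      moreover have "z \<in> dom f" "real_of_ereal (f z) \<le> (1 - t) * r + t * b"
        using Gamma0_convex_comb[OF f x0 \<open>y \<in> dom f\<close>, of t] t by (auto simp: z_def r_def b_def)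
      ultimately have "r - 1 < (1 - t) * r + t * b"
        by (auto elim: Gamma0_dom_cases[OF f, of z])
      then have "t * (r - b) < 1" by (simp add: algebra_simps)
      then have "r - b < 1 / t" using t by (simp add: field_simps)
      moreover have "1 / t = N / e" using N e by (simp add: t_def)
      ultimately show ?thesis by (simp add: b N_def)
    qed
  qed
  show thesis
  proof (rule that[of "1 / e" "r - 1 - norm x0 / e"])
    show "0 \<le> 1 / e" using e by simp
    fix y
    have "norm (y - x0) / e \<le> (norm y + norm x0) / e"
      using e by (simp add: divide_right_mono norm_triangle_ineq4)
    then have "r - 1 - norm x0 / e - 1 / e * norm y \<le> r - 1 - norm (y - x0) / e"
      by (simp add: add_divide_distrib)
    then show "ereal (r - 1 - norm x0 / e - 1 / e * norm y) \<le> f y"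
      using main[of y] by (meson ereal_less_eq(3) order_trans)
  qed
qed

section \<open>Subgradient inequalities in real numbers\<close>

lemma subdiff_real:
  assumes "f \<in> Gamma0" "u \<in> subdiff f x"
  shows "x \<in> dom f" "\<And>y. y \<in> dom f \<Longrightarrow> real_of_ereal (f x) + u \<bullet> (y - x) \<le> real_of_ereal (f y)"
proof -
  show x: "x \<in> dom f" using assms by (auto simp: subdiff_def dom_def)
  fix y assume y: "y \<in> dom f"
  have "f x + ereal (u \<bullet> (y - x)) \<le> f y" using assms by (auto simp: subdiff_def)
  then show "real_of_ereal (f x) + u \<bullet> (y - x) \<le> real_of_ereal (f y)"
    by (rule_tac Gamma0_dom_cases[OF assms(1) x], rule_tac Gamma0_dom_cases[OF assms(1) y]) simp
qed

lemma subdiff_realI: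
  assumes "f \<in> Gamma0" "x \<in> dom f"
    and "\<And>y. y \<in> dom f \<Longrightarrow> real_of_ereal (f x) + u \<bullet> (y - x) \<le> real_of_ereal (f y)"
  shows "u \<in> subdiff f x"
proof -
  have "f x + ereal (u \<bullet> (y - x)) \<le> f y" for y
  proof (cases "y \<in> dom f")
    case True
    with assms(3)[OF True] show ?thesis
      by (rule_tac Gamma0_dom_cases[OF assms(1,2)], rule_tac Gamma0_dom_cases[OF assms(1) True]) simp
  qed (simp add: dom_def)
  moreover have "f x \<noteq> \<infinity>" "f x \<noteq> -\<infinity>"
    by (rule Gamma0_dom_cases[OF assms(1,2)], simp)+
  ultimately show ?thesis by (simp add: subdiff_def)
qed

lemma subdiff_monotone:
  assumes "f \<in> Gamma0" "u \<in> subdiff f x" "w \<in> subdiff f y"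
  shows "0 \<le> (u - w) \<bullet> (x - y)"
  using subdiff_real(2)[OF assms(1,2) subdiff_real(1)[OF assms(1,3)]]
    subdiff_real(2)[OF assms(1,3) subdiff_real(1)[OF assms(1,2)]]
  by (simp add: inner_diff_left inner_diff_right)

section \<open>Resolvents and what they approximate\<close>

lemma Gamma0_plus_quadratic_bounded_below:
  fixes f :: "'a::real_inner \<Rightarrow> ereal"
  assumes f: "f \<in> Gamma0" and c: "c > 0"
  obtains m where "\<And>y. y \<in> dom f \<Longrightarrow> m \<le> real_of_ereal (f y) + c * (norm (y - x))\<^sup>2"
proof -
  obtain a k where k: "0 \<le> k" "\<And>y. ereal (a - k * norm y) \<le> f y"
    by (rule Gamma0_linear_minorant[OF f]) (meson that)
  \<comment> \<open>The last term is the minimum of \<open>c * s^2 - k * s\<close> over real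
    \<open>s\<close>, attained at \<open>s = k / (2 * c)\<close>; the square below is completed
    there.\<close>
  show thesis
  proof (rule that[of "a - k * norm x - k\<^sup>2 / (4 * c)"])
    fix y assume "y \<in> dom f"
    then have "a - k * norm y \<le> real_of_ereal (f y)"
      using k(2)[of y] by (auto elim: Gamma0_dom_cases[OF f])
    moreover have "k * norm y \<le> k * norm x + k * norm (y - x)"
      using mult_left_mono[OF norm_triangle_sub[of y x] k(1)] by (simp add: algebra_simps)
    moreover have "c * (norm (y - x) - k / (2 * c))\<^sup>2
        = c * (norm (y - x))\<^sup>2 + k\<^sup>2 / (4 * c) - k * norm (y - x)"
      using c by (simp add: power2_eq_square field_simps)
    moreover have "0 \<le> c * (norm (y - x) - k / (2 * c))\<^sup>2" using c by simp
    ultimately show "a - k * norm x - k\<^sup>2 / (4 * c) \<le> real_of_ereal (f y) + c * (norm (y - x))\<^sup>2"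
      by linarith
  qed
qed

text \<open>The point \<open>p\<close> minimises \<open>f\<close> plus \<open>c / 2\<close> times
  the squared distance to \<open>x\<close>. Strong convexity makes minimising sequences Cauchy, so
  completeness and lower semicontinuity give a minimiser without weak compactness; its first-order
  condition is the claim.\<close>

lemma resolvent_exists:
  fixes f :: "'a::{real_inner, complete_space} \<Rightarrow> ereal"
  assumes f: "f \<in> Gamma0" and c: "c > 0"
  obtains p where "c *\<^sub>R (x - p) \<in> subdiff f p"
proof -
  define F where "F = (\<lambda>y. real_of_ereal (f y))"
  define H where "H = (\<lambda>y. F y + c / 2 * (norm (y - x))\<^sup>2)"
  have fF: "f y = ereal (F y)" if "y \<in> dom f" for y
    using Gamma0_dom_ereal[OF f that] by (simp add: F_def)
  obtain m0 where m0: "\<And>y. y \<in> dom f \<Longrightarrow> m0 \<le> H y"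
    using Gamma0_plus_quadratic_bounded_below[OF f, of "c / 2" x] c by (auto simp: H_def F_def)
  define m where "m = Inf (H ` dom f)"
  have ne: "H ` dom f \<noteq> {}" using Gamma0_dom_nonempty[OF f] by blast
  have bdd: "bdd_below (H ` dom f)" using m0 by (auto intro!: bdd_belowI[of _ m0])
  have mH: "m \<le> H y" if "y \<in> dom f" for y
    unfolding m_def using that bdd by (auto intro: cInf_lower)
  have "\<exists>y\<in>dom f. H y < m + 1 / Suc n" for n
    using cInf_lessD[OF ne, of "m + 1 / Suc n"] by (auto simp: m_def)
  then obtain s where s: "\<And>n. s n \<in> dom f" "\<And>n. H (s n) < m + 1 / Suc n"
    by metis
  \<comment> \<open>Evaluating \<open>H\<close> at the midpoint of \<open>a\<close> and
    \<open>b\<close>, with the parallelogram law, shows that two nearly minimal points are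
    close.\<close>
  have gap: "c / 8 * (norm (a - b))\<^sup>2 \<le> (H a + H b) / 2 - m" if ab: "a \<in> dom f" "b \<in> dom f" for a b
  proof -
    define z where "z = (1 - 1 / 2) *\<^sub>R a + (1 / 2 :: real) *\<^sub>R b"
    have z: "z \<in> dom f" "F z \<le> F a / 2 + F b / 2"
      using Gamma0_convex_comb[OF f ab, of "1/2"] by (auto simp: z_def F_def)
    have zx: "z - x = (1/2) *\<^sub>R ((a - x) + (b - x))" by (simp add: z_def algebra_simps flip: scaleR_2)
    have "(norm ((1/2) *\<^sub>R (s + t)))\<^sup>2 = (norm s)\<^sup>2 / 2 + (norm t)\<^sup>2 / 2 - (norm (s - t))\<^sup>2 / 4"
      for s t :: 'a
      unfolding power2_norm_eq_inner
      by (simp add: inner_add_left inner_add_right inner_diff_left inner_diff_right inner_commute field_simps)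
    from this[of "a - x" "b - x"]
    have zn: "(norm (z - x))\<^sup>2 = (norm (a - x))\<^sup>2 / 2 + (norm (b - x))\<^sup>2 / 2 - (norm (a - b))\<^sup>2 / 4"
      unfolding zx by simp
    have "c / 2 * (norm (z - x))\<^sup>2
        = c / 4 * (norm (a - x))\<^sup>2 + c / 4 * (norm (b - x))\<^sup>2 - c / 8 * (norm (a - b))\<^sup>2"
      unfolding zn by (simp add: algebra_simps)
    then have "H z \<le> (H a + H b) / 2 - c / 8 * (norm (a - b))\<^sup>2"
      using z(2) by (simp add: H_def algebra_simps)
    with mH[OF z(1)] show ?thesis by linarith
  qed
  have "Cauchy s"
  proof (rule metric_CauchyI)
    fix e :: real assume e: "e > 0"
    have "c / 8 * e\<^sup>2 > 0" using c e by simp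
    then obtain N where "inverse (Suc N) < c / 8 * e\<^sup>2" using reals_Archimedean by blast
    moreover define d where "d = inverse (real (Suc N))"
    ultimately have d: "d < c / 8 * e\<^sup>2" by simp
    show "\<exists>M. \<forall>i\<ge>M. \<forall>j\<ge>M. dist (s i) (s j) < e"
    proof (intro exI allI impI)
      fix i j assume ij: "i \<ge> N" "j \<ge> N"
      have "1 / real (Suc i) \<le> d" "1 / real (Suc j) \<le> d"
        using ij by (auto simp: d_def field_simps)
      then have "H (s i) < m + d" "H (s j) < m + d"
        using s(2)[of i] s(2)[of j] by linarith+
      then have "c / 8 * (norm (s i - s j))\<^sup>2 < c / 8 * e\<^sup>2"
        using gap[OF s(1)[of i] s(1)[of j]] d by argo
      then have "(norm (s i - s j))\<^sup>2 < e\<^sup>2" using c by simp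
      then show "dist (s i) (s j) < e" using e by (simp add: dist_norm power_less_imp_less_base)
    qed
  qed
  then obtain p where p: "s \<longlonglongrightarrow> p" using Cauchy_convergent convergent_def by blast
  have "(\<lambda>n. H (s n)) \<longlonglongrightarrow> m"
  proof (rule tendsto_sandwich[of "\<lambda>_. m" _ _ "\<lambda>n. m + 1 / Suc n"])
    show "(\<lambda>n. m + 1 / real (Suc n)) \<longlonglongrightarrow> m"
      using tendsto_add[OF tendsto_const[of m] LIMSEQ_inverse_real_of_nat] by (simp add: inverse_eq_divide)
  qed (use s mH in \<open>auto intro!: always_eventually less_imp_le simp del: of_nat_Suc\<close>)
  then have "(\<lambda>n. H (s n) - c / 2 * (norm (s n - x))\<^sup>2) \<longlonglongrightarrow> m - c / 2 * (norm (p - x))\<^sup>2"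
    by (intro tendsto_intros p)
  then have "(\<lambda>n. f (s n)) \<longlonglongrightarrow> ereal (m - c / 2 * (norm (p - x))\<^sup>2)"
    by (simp add: fF[OF s(1)] H_def)
  then have fp: "f p \<le> ereal (m - c / 2 * (norm (p - x))\<^sup>2)"
    using f p lsc_le_limit[of f s p sequentially] unfolding Gamma0_def by auto
  then have pd: "p \<in> dom f" by (auto simp: dom_def)
  have Fp: "F p \<le> m - c / 2 * (norm (p - x))\<^sup>2" using fp fF[OF pd] by simp
  have "c *\<^sub>R (x - p) \<in> subdiff f p"
  proof (rule subdiff_realI[OF f pd])
    fix y assume y: "y \<in> dom f"
    \<comment> \<open>\<open>A + t * B\<close> bounds from above the difference quotient of
      \<open>H\<close> from \<open>p\<close> towards \<open>y\<close>, so it is nonnegative. As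
      \<open>t\<close> tends to 0 only \<open>A\<close> remains, and \<open>0 \<le> A\<close> is the
      subgradient inequality.\<close>
    define A where "A = F y - F p + c * ((p - x) \<bullet> (y - p))"
    define B where "B = c / 2 * (norm (y - p))\<^sup>2"
    have ineq: "0 \<le> A + t * B" if t: "0 < t" "t \<le> 1" for t
    proof -
      define z where "z = (1 - t) *\<^sub>R p + t *\<^sub>R y"
      have z: "z \<in> dom f" "F z \<le> (1 - t) * F p + t * F y"
        using Gamma0_convex_comb[OF f pd y, of t] t by (auto simp: z_def F_def)
      have zx: "z - x = (p - x) + t *\<^sub>R (y - p)" by (simp add: z_def algebra_simps)
      have zn: "(norm (z - x))\<^sup>2 = (norm (p - x))\<^sup>2 + 2 * t * ((p - x) \<bullet> (y - p)) + t\<^sup>2 * (norm (y - p))\<^sup>2"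
        unfolding zx power2_norm_eq_inner inner_add_left inner_add_right
        by (simp add: inner_commute power2_eq_square)
      have "c / 2 * (norm (z - x))\<^sup>2
          = c / 2 * (norm (p - x))\<^sup>2 + t * (c * ((p - x) \<bullet> (y - p))) + t * (t * B)"
        unfolding zn B_def by (simp add: algebra_simps power2_eq_square)
      moreover have "t * (A + t * B)
          = t * F y - t * F p + t * (c * ((p - x) \<bullet> (y - p))) + t * (t * B)"
        unfolding A_def by (simp add: algebra_simps)
      moreover have "(1 - t) * F p = F p - t * F p" by (simp add: algebra_simps)
      ultimately have "0 \<le> t * (A + t * B)"
        using mH[OF z(1)] z(2) Fp unfolding H_def by linarith
      then show ?thesis using t by (simp add: zero_le_mult_iff)
    qed
    have lim: "((\<lambda>t. A + t * B) \<longlongrightarrow> A + 0 * B) (at_right 0)" by (intro tendsto_intros)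
    have "0 \<le> A + 0 * B"
    proof (rule tendsto_lowerbound[OF lim])
      show "eventually (\<lambda>t. 0 \<le> A + t * B) (at_right 0)"
        unfolding eventually_at_right_field using ineq by (intro exI[of _ 1]) auto
    qed simp
    then show "real_of_ereal (f p) + c *\<^sub>R (x - p) \<bullet> (y - p) \<le> real_of_ereal (f y)"
      by (simp add: A_def F_def inner_diff_left algebra_simps)
  qed
  then show thesis using that by blast
qed

text \<open>Monotonicity of the subdifferential makes the point in the definite description
  unique.\<close>

lemma prox_eq:
  assumes f: "f \<in> Gamma0" and p: "x - p \<in> subdiff f p"
  shows "prox f x = p"
  unfolding prox_def
proof (rule the_equality)
  show "x - p \<in> subdiff f p" by (rule p)
next
  fix q assume "x - q \<in> subdiff f q"
  from subdiff_monotone[OF f p this] have "(q - p) \<bullet> (q - p) \<le> 0"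
    by (simp add: inner_diff_left inner_diff_right inner_commute)
  then show "q = p" by (metis inner_gt_zero_iff not_le right_minus_eq)
qed

lemma prox_subdiff:
  fixes f :: "'a::{real_inner, complete_space} \<Rightarrow> ereal"
  assumes f: "f \<in> Gamma0"
  shows "x - prox f x \<in> subdiff f (prox f x)"
proof -
  obtain p where "1 *\<^sub>R (x - p) \<in> subdiff f p" using resolvent_exists[OF f, of 1 x] by auto
  then show ?thesis using prox_eq[OF f] by simp
qed

text \<open>The second hypothesis bounds by \<open>a\<close> the value at \<open>z\<close> of every
  affine minorant coming from a subgradient. Applied to resolvents of \<open>z\<close> with growing
  parameter, it bounds their values and forces them towards \<open>z\<close>. It serves both the
  density of \<open>dom_subdiff f\<close> in \<open>dom f\<close> and weak lower
  semicontinuity.\<close>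

lemma resolvent_approximation:
  fixes f :: "'a::{real_inner, complete_space} \<Rightarrow> ereal"
  assumes f: "f \<in> Gamma0"
    and a: "\<And>p u. u \<in> subdiff f p \<Longrightarrow> real_of_ereal (f p) + u \<bullet> (z - p) \<le> a"
  obtains q where "q \<longlonglongrightarrow> z" "\<And>k::nat. q k \<in> dom_subdiff f" "\<And>k. f (q k) \<le> ereal a"
proof -
  obtain m where m: "\<And>y. y \<in> dom f \<Longrightarrow> m \<le> real_of_ereal (f y) + 1 * (norm (y - z))\<^sup>2"
    by (rule Gamma0_plus_quadratic_bounded_below[OF f, of 1 z]) (simp, meson)
  \<comment> \<open>Of the factor \<open>k + 2\<close>, one unit is spent on the lower bound
    \<open>m\<close>; the remaining \<open>k + 1\<close> drives the distance to zero.\<close>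
  have "\<exists>p. (real k + 2) *\<^sub>R (z - p) \<in> subdiff f p" for k
    by (rule resolvent_exists[OF f, of "real k + 2" z]) auto
  then obtain q where q: "\<And>k. (real k + 2) *\<^sub>R (z - q k) \<in> subdiff f (q k)" by metis
  have val: "real_of_ereal (f (q k)) + (real k + 2) * (norm (q k - z))\<^sup>2 \<le> a" for k
    using a[OF q] by (simp add: power2_norm_eq_inner[symmetric] norm_minus_commute)
  have dom: "q k \<in> dom f" for k using subdiff_real(1)[OF f q] .
  have bound: "norm (q k - z) \<le> sqrt ((a - m) * (1 / Suc k))" for k
  proof (rule real_le_rsqrt)
    have "(real k + 1) * (norm (q k - z))\<^sup>2 \<le> a - m"
      using val[of k] m[OF dom[of k]] by (simp add: algebra_simps)
    then show "(norm (q k - z))\<^sup>2 \<le> (a - m) * (1 / Suc k)" by (simp add: field_simps)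
  qed
  have "(\<lambda>k. sqrt ((a - m) * (1 / Suc k))) \<longlonglongrightarrow> sqrt ((a - m) * 0)"
    using LIMSEQ_inverse_real_of_nat by (intro tendsto_intros) (simp add: inverse_eq_divide)
  then have "(\<lambda>k. sqrt ((a - m) * (1 / Suc k))) \<longlonglongrightarrow> 0" by simp
  from Lim_null_comparison[OF always_eventually[OF allI[OF bound]] this]
  have "q \<longlonglongrightarrow> z" by (rule LIM_zero_cancel)
  moreover have "q k \<in> dom_subdiff f" for k using q unfolding dom_subdiff_def by blast
  moreover have "f (q k) \<le> ereal a" for k
  proof -
    have "real_of_ereal (f (q k)) \<le> a"
      using val[of k] by (smt (verit) mult_nonneg_nonneg of_nat_0_le_iff zero_le_power2)
    then show ?thesis by (rule_tac Gamma0_dom_cases[OF f dom[of k]]) simp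
  qed
  ultimately show thesis using that by blast
qed

lemma dom_subset_closure_dom_subdiff:
  fixes f :: "'a::{real_inner, complete_space} \<Rightarrow> ereal"
  assumes f: "f \<in> Gamma0" shows "dom f \<subseteq> closure (dom_subdiff f)"
proof
  fix z assume z: "z \<in> dom f"
  obtain q where "q \<longlonglongrightarrow> z" "\<And>k::nat. q k \<in> dom_subdiff f"
    by (rule resolvent_approximation[OF f subdiff_real(2)[OF f _ z]]) auto
  then show "z \<in> closure (dom_subdiff f)" unfolding closure_sequential by blast
qed

text \<open>Affine minorants are weakly continuous, so their values at \<open>z\<close> are at most
  \<open>a\<close>; the resolvents of \<open>z\<close> then converge strongly, where plain lower
  semicontinuity applies. A general filter \<open>G\<close> is allowed because cluster points are
  later obtained along filters, not subsequences.\<close>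

lemma Gamma0_weak_lsc:
  fixes f :: "'a::{real_inner, complete_space} \<Rightarrow> ereal"
  assumes f: "f \<in> Gamma0" and G: "G \<noteq> bot"
    and weak: "\<And>y. ((\<lambda>n. s n \<bullet> y) \<longlongrightarrow> z \<bullet> y) G"
    and val: "((\<lambda>n. real_of_ereal (f (s n))) \<longlongrightarrow> a) G" and dom: "\<And>n. s n \<in> dom f"
  shows "f z \<le> ereal a"
proof -
  have "real_of_ereal (f p) + u \<bullet> (z - p) \<le> a" if u: "u \<in> subdiff f p" for p u
  proof (rule tendsto_le[OF G val])
    have "((\<lambda>n. real_of_ereal (f p) + (s n \<bullet> u - u \<bullet> p)) \<longlongrightarrow> real_of_ereal (f p) + (z \<bullet> u - u \<bullet> p)) G"
      by (intro tendsto_intros weak)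
    then show "((\<lambda>n. real_of_ereal (f p) + u \<bullet> (s n - p)) \<longlongrightarrow> real_of_ereal (f p) + u \<bullet> (z - p)) G"
      by (simp add: inner_diff_right inner_commute)
    show "\<forall>\<^sub>F n in G. real_of_ereal (f p) + u \<bullet> (s n - p) \<le> real_of_ereal (f (s n))"
      using subdiff_real(2)[OF f u dom] by simp
  qed
  then obtain q where q: "q \<longlonglongrightarrow> z" "\<And>k::nat. f (q k) \<le> ereal a"
    by (rule resolvent_approximation[OF f]) auto
  show ?thesis
  proof (rule ccontr)
    assume "\<not> f z \<le> ereal a"
    then have "eventually (\<lambda>y. ereal a < f y) (nhds z)"
      using f lsc_eventually[of f "ereal a" z] by (simp add: Gamma0_def not_le)
    then have "eventually (\<lambda>k. ereal a < f (q k)) sequentially"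
      using q(1) unfolding filterlim_iff by blast
    then obtain k where "ereal a < f (q k)" using eventually_happens trivial_limit_sequentially by blast
    with q(2)[of k] show False by simp
  qed
qed

text \<open>A resolvent with parameter \<open>1 / Suc k\<close> based at \<open>Suc k\<close> times
  \<open>u\<close> yields a subgradient differing from \<open>u\<close> by
  \<open>p k / Suc k\<close>. Finiteness of the conjugate at \<open>u\<close> makes this error
  vanish.\<close>

lemma dom_conj_subset_closure_ran_subdiff:
  fixes f :: "'a::{real_inner, complete_space} \<Rightarrow> ereal"
  assumes f: "f \<in> Gamma0" shows "dom (conj f) \<subseteq> closure (ran_subdiff f)"
proof
  fix u assume "u \<in> dom (conj f)"
  then obtain K where "conj f u < ereal K" unfolding dom_def by (metis ereal_dense2 mem_Collect_eq)
  then have K0: "ereal (u \<bullet> y) - f y \<le> ereal K" for y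
    unfolding conj_def by (meson SUP_upper UNIV_I less_imp_le order_trans)
  have K: "u \<bullet> y - real_of_ereal (f y) \<le> K" if "y \<in> dom f" for y
    using K0[of y] by (rule_tac Gamma0_dom_cases[OF f that]) simp
  obtain x0 where x0: "x0 \<in> dom f" using Gamma0_dom_nonempty[OF f] .
  have "\<exists>p. u - (1 / Suc k) *\<^sub>R p \<in> subdiff f p" for k
  proof -
    obtain p where "(1 / real (Suc k)) *\<^sub>R (real (Suc k) *\<^sub>R u - p) \<in> subdiff f p"
      by (rule resolvent_exists[OF f, of "1 / real (Suc k)" "real (Suc k) *\<^sub>R u"])
        (auto simp del: of_nat_Suc)
    then show ?thesis
      by (intro exI[of _ p]) (simp add: scaleR_right_diff_distrib del: of_nat_Suc)
  qed
  then obtain p where p: "\<And>k. u - (1 / Suc k) *\<^sub>R p k \<in> subdiff f (p k)" by metis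
  define A where "A = \<bar>real_of_ereal (f x0) - u \<bullet> x0 + K\<bar>"
  \<comment> \<open>With \<open>e = 1 / Suc k\<close> and \<open>n\<close> the norm of the error,
    the estimate is \<open>n^2 \<le> e * A + e * n * norm x0\<close>. Young's inequality absorbs
    half of \<open>n^2\<close>, which leaves \<open>h k\<close>.\<close>
  define h where "h = (\<lambda>k::nat. 2 * A * (1 / Suc k) + (norm x0)\<^sup>2 * (1 / Suc k)\<^sup>2)"
  have bound: "norm ((1 / Suc k) *\<^sub>R p k) \<le> sqrt (h k)" for k
  proof (rule real_le_rsqrt)
    define e where "e = 1 / real (Suc k)"
    define n where "n = norm (e *\<^sub>R p k)"
    have e: "e > 0" by (simp add: e_def)
    have "real_of_ereal (f (p k)) + (u - e *\<^sub>R p k) \<bullet> (x0 - p k) \<le> real_of_ereal (f x0)"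
      using subdiff_real(2)[OF f p x0] by (simp add: e_def)
    then have "e * (p k \<bullet> p k) \<le> A + e * (p k \<bullet> x0)"
      using K[OF subdiff_real(1)[OF f p]] unfolding A_def
      by (smt (verit) inner_diff_left inner_diff_right inner_scaleR_left right_diff_distrib)
    then have "e * (e * (p k \<bullet> p k)) \<le> e * (A + e * (p k \<bullet> x0))"
      using e by (intro mult_left_mono) auto
    moreover have "n\<^sup>2 = e * (e * (p k \<bullet> p k))"
      by (simp add: n_def power2_norm_eq_inner del: norm_scaleR)
    moreover have "e * (p k \<bullet> x0) \<le> n * norm x0"
      using norm_cauchy_schwarz[of "e *\<^sub>R p k" x0] by (simp add: n_def del: norm_scaleR)
    then have "e * (A + e * (p k \<bullet> x0)) \<le> e * (A + n * norm x0)"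
      using e by (intro mult_left_mono) auto
    moreover have "0 \<le> (n - e * norm x0)\<^sup>2" by simp
    ultimately have "n\<^sup>2 \<le> 2 * A * e + (norm x0)\<^sup>2 * e\<^sup>2"
      by (simp add: power2_eq_square algebra_simps)
    then show "(norm ((1 / Suc k) *\<^sub>R p k))\<^sup>2 \<le> h k" by (simp add: n_def e_def h_def)
  qed
  have "(\<lambda>k. sqrt (h k)) \<longlonglongrightarrow> sqrt (2 * A * 0 + (norm x0)\<^sup>2 * 0\<^sup>2)"
    unfolding h_def using LIMSEQ_inverse_real_of_nat by (intro tendsto_intros) (simp_all add: inverse_eq_divide)
  then have "(\<lambda>k. sqrt (h k)) \<longlonglongrightarrow> 0" by simp
  from tendsto_diff[OF tendsto_const Lim_null_comparison[OF always_eventually[OF allI[OF bound]] this]]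
  have "(\<lambda>k. u - (1 / Suc k) *\<^sub>R p k) \<longlonglongrightarrow> u - 0" .
  moreover have "u - (1 / Suc k) *\<^sub>R p k \<in> ran_subdiff f" for k
    using p unfolding ran_subdiff_def by blast
  ultimately show "u \<in> closure (ran_subdiff f)"
    unfolding closure_sequential by (metis (no_types, lifting) diff_zero)
qed

section \<open>Projections onto closed convex sets\<close>

lemma indicator_Gamma0:
  fixes C :: "'a::real_inner set"
  assumes C: "convex C" "closed C" "C \<noteq> {}"
  shows "(\<lambda>y. if y \<in> C then 0 else \<infinity>) \<in> Gamma0" (is "?i \<in> _")
proof -
  have "?i ((1 - t) *\<^sub>R x + t *\<^sub>R y) \<le> ereal (1 - t) * ?i x + ereal t * ?i y"
    if t: "0 \<le> t" "t \<le> 1" for x y t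
  proof -
    \<comment> \<open>The endpoints are separate because \<open>0 * \<infinity> = 0\<close> in
      \<open>ereal\<close>: there a point outside \<open>C\<close> does not make the right-hand side
      infinite.\<close>
    consider "t = 0" | "t = 1" | "0 < t" "t < 1" using t by linarith
    then show ?thesis
    proof cases
      case 3
      then show ?thesis using C(1) by (auto simp: convex_alt)
    qed auto
  qed
  moreover have "?i x \<le> Liminf (at x) ?i" for x
  proof (cases "x \<in> C")
    case True
    then show ?thesis by (auto intro!: Liminf_bounded always_eventually)
  next
    case False
    then have "eventually (\<lambda>y. y \<in> - C) (at x)"
      using C(2) by (intro eventually_at_topological[THEN iffD2]) (auto simp: closed_def)
    then have "eventually (\<lambda>y. ?i x \<le> ?i y) (at x)" by (rule eventually_mono) auto
    then show ?thesis by (rule Liminf_bounded)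
  qed
  ultimately show ?thesis
    using C(3) by (auto simp: Gamma0_def ereal_convex_def lsc_def proper_def)
qed

text \<open>The resolvent of the indicator function of \<open>C\<close> is the projection, and its
  subgradient inequality is the variational inequality.\<close>

lemma projection_exists:
  fixes C :: "'a::{real_inner, complete_space} set"
  assumes C: "convex C" "closed C" "C \<noteq> {}"
  obtains p where "p \<in> C" "\<And>y. y \<in> C \<Longrightarrow> (x - p) \<bullet> (y - p) \<le> 0"
proof -
  let ?i = "\<lambda>y. if y \<in> C then 0 else \<infinity> :: ereal"
  obtain p where "1 *\<^sub>R (x - p) \<in> subdiff ?i p"
    using resolvent_exists[OF indicator_Gamma0[OF C], of 1 x] by auto
  then have fin: "?i p \<noteq> \<infinity>" and ineq: "\<forall>y. ?i p + ereal ((x - p) \<bullet> (y - p)) \<le> ?i y"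
    unfolding subdiff_def by simp_all
  from fin have p: "p \<in> C" by presburger
  moreover have "(x - p) \<bullet> (y - p) \<le> 0" if "y \<in> C" for y
    using ineq[rule_format, of y] p that by simp
  ultimately show thesis by (rule that)
qed

text \<open>The variational inequality yields the Pythagorean estimate \<open>key\<close>, which
  gives minimality and uniqueness together.\<close>

lemma proj_eq:
  fixes C :: "'a::real_inner set"
  assumes p: "p \<in> C" "\<And>y. y \<in> C \<Longrightarrow> (x - p) \<bullet> (y - p) \<le> 0"
  shows "proj C x = p"
proof -
  have key: "(dist x p)\<^sup>2 + (norm (y - p))\<^sup>2 \<le> (dist x y)\<^sup>2" if "y \<in> C" for y
  proof -
    have "(norm ((x - p) - (y - p)))\<^sup>2 = (norm (x - p))\<^sup>2 + (norm (y - p))\<^sup>2 - 2 * ((x - p) \<bullet> (y - p))"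
      unfolding power2_norm_eq_inner by (simp add: inner_diff_left inner_diff_right inner_commute)
    with p(2)[OF that] show ?thesis by (simp add: dist_norm)
  qed
  show ?thesis unfolding proj_def
  proof (rule the_equality)
    have "dist x p \<le> dist x y" if "y \<in> C" for y
    proof (rule power2_le_imp_le)
      show "(dist x p)\<^sup>2 \<le> (dist x y)\<^sup>2"
        using key[OF that] zero_le_power2[of "norm (y - p)"] by linarith
    qed simp
    then show "p \<in> C \<and> (\<forall>y\<in>C. dist x p \<le> dist x y)" using p(1) by blast
    fix q assume q: "q \<in> C \<and> (\<forall>y\<in>C. dist x q \<le> dist x y)"
    then have "dist x q \<le> dist x p" using p(1) by blast
    then have "(dist x q)\<^sup>2 \<le> (dist x p)\<^sup>2" by (rule power_mono) simp
    with key[of q] q have "(norm (q - p))\<^sup>2 \<le> 0" by linarith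
    then show "q = p" by simp
  qed
qed

section \<open>Weak compactness of bounded families\<close>

lemma Riesz_representation:
  fixes L :: "'a::{real_inner, complete_space} \<Rightarrow> real"
  assumes L: "bounded_linear L"
  obtains z where "\<And>y. L y = z \<bullet> y"
proof -
  interpret bounded_linear L by (rule L)
  let ?f = "\<lambda>y. ereal (L y)"
  have "ereal_convex ?f" by (auto simp: ereal_convex_def add scaleR)
  moreover have "?f x \<le> Liminf (at x) ?f" for x
  proof (cases "at x = bot")
    case False
    have "(?f \<longlongrightarrow> ?f x) (at x)" using linear_continuous_at[OF L, of x] by (simp add: isCont_def)
    from lim_imp_Liminf[OF False this] show ?thesis by simp
  qed simp
  ultimately have "?f \<in> Gamma0" by (auto simp: Gamma0_def lsc_def proper_def)
  \<comment> \<open>The only subgradient of a linear functional is its representing vector, so the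
    resolvent of 0 is minus that vector. Testing at \<open>p + y\<close> and \<open>p - y\<close>
    turns the inequality into an equality.\<close>
  then obtain p where "1 *\<^sub>R (0 - p) \<in> subdiff ?f p" using resolvent_exists[of ?f 1 0] by auto
  then have p: "L p - p \<bullet> (y - p) \<le> L y" for y by (auto simp: subdiff_def)
  have "L y = (- p) \<bullet> y" for y
    using p[of "p + y"] p[of "p - y"] by (simp add: add diff)
  then show thesis using that by blast
qed

text \<open>Each \<open>s n\<close> is seen as the function sending \<open>y\<close> to its inner
  product with \<open>s n\<close>, a point in a product of compact intervals. A cluster point there
  is linear and bounded, hence represented by a vector.\<close>

lemma bounded_weak_cluster:
  fixes s :: "'b \<Rightarrow> 'a::{real_inner, complete_space}"
  assumes M: "\<And>n. norm (s n) \<le> M" and F: "F \<noteq> bot"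
  obtains z G where "G \<noteq> bot" "G \<le> F" "\<And>y. ((\<lambda>n. s n \<bullet> y) \<longlongrightarrow> z \<bullet> y) G"
proof -
  define K where "K = PiE UNIV (\<lambda>y::'a. cball (0::real) (M * norm y))"
  define \<phi> where "\<phi> = (\<lambda>n y. s n \<bullet> y)"
  have "compactin (product_topology (\<lambda>y. euclidean) UNIV) K"
    unfolding K_def by (rule compactin_PiE[THEN iffD2]) auto
  then have K: "compact K" by (simp add: euclidean_product_topology)
  have bd: "\<bar>s n \<bullet> y\<bar> \<le> M * norm y" for n y
    by (meson Cauchy_Schwarz_ineq2 M mult_right_mono norm_ge_zero order_trans)
  then have "\<phi> n \<in> K" for n by (auto simp: K_def \<phi>_def)
  then have "eventually (\<lambda>t. t \<in> K) (filtermap \<phi> F)" by (simp add: eventually_filtermap)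
  moreover have "filtermap \<phi> F \<noteq> bot" using F by (simp add: filtermap_bot_iff)
  ultimately obtain l where l: "l \<in> K" "inf (nhds l) (filtermap \<phi> F) \<noteq> bot"
    using K unfolding compact_filter by blast
  \<comment> \<open>The cluster property lives on the image filter; pulling the neighbourhoods of
    \<open>l\<close> back along \<open>\<phi>\<close> gives a filter on the indices
    themselves.\<close>
  define G where "G = inf (filtercomap \<phi> (nhds l)) F"
  have G: "G \<noteq> bot"
  proof
    assume "G = bot"
    then obtain P Q where PQ: "eventually P (filtercomap \<phi> (nhds l))" "eventually Q F" "\<And>n. P n \<Longrightarrow> Q n \<Longrightarrow> False"
      unfolding G_def trivial_limit_def eventually_inf by blast
    then obtain P' where P': "eventually P' (nhds l)" "\<And>n. P' (\<phi> n) \<Longrightarrow> P n"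
      unfolding eventually_filtercomap by blast
    have "eventually (\<lambda>t. \<not> P' t) (filtermap \<phi> F)"
      unfolding eventually_filtermap using PQ(2) by (rule eventually_mono) (use PQ(3) P'(2) in blast)
    with P'(1) have "eventually (\<lambda>_. False) (inf (nhds l) (filtermap \<phi> F))"
      unfolding eventually_inf by blast
    with l(2) show False by (simp add: trivial_limit_def)
  qed
  have "filterlim \<phi> (nhds l) G"
    unfolding G_def by (rule filterlim_mono[OF filterlim_filtercomap order_refl inf_le1])
  then have lim: "((\<lambda>n. s n \<bullet> y) \<longlongrightarrow> l y) G" for y
    using continuous_on_product_coordinates[of y]
      continuous_on_tendsto_compose[of UNIV "\<lambda>t. t y" \<phi> l G] by (simp add: \<phi>_def)
  have "bounded_linear l"
  proof (rule bounded_linear_intro)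
    show "l (a + b) = l a + l b" for a b
      by (rule tendsto_unique[OF G lim]) (use tendsto_add[OF lim lim] in \<open>simp add: inner_add_right\<close>)
    show "l (r *\<^sub>R a) = r *\<^sub>R l a" for r a
      by (rule tendsto_unique[OF G lim]) (use tendsto_mult_left[OF lim] in simp)
    show "norm (l y) \<le> norm y * M" for y
      using l(1) by (auto simp: K_def PiE_def Pi_def mult.commute)
  qed
  then obtain z where "\<And>y. l y = z \<bullet> y" using Riesz_representation by metis
  with G lim show thesis using that[of G z] by (simp add: G_def)
qed

text \<open>The bound forces equality: the affine minorant with slope \<open>u\<close> also touches
  \<open>f\<close> at \<open>z'\<close>.\<close>

lemma subdiff_transfer:
  assumes f: "f \<in> Gamma0" and u: "u \<in> subdiff f z"
    and le: "f z' \<le> ereal (real_of_ereal (f z) + u \<bullet> (z' - z))"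
  shows "u \<in> subdiff f z'"
proof -
  have d: "z' \<in> dom f" using le by (auto simp: dom_def)
  have "real_of_ereal (f z') \<le> real_of_ereal (f z) + u \<bullet> (z' - z)"
    using le by (rule_tac Gamma0_dom_cases[OF f d]) simp
  then have eq: "real_of_ereal (f z') = real_of_ereal (f z) + u \<bullet> (z' - z)"
    using subdiff_real(2)[OF f u d] by linarith
  show "u \<in> subdiff f z'"
    by (rule subdiff_realI[OF f d])
      (use subdiff_real(2)[OF f u] in \<open>simp add: eq inner_diff_right algebra_simps\<close>)
qed

text \<open>The pair \<open>(z, u)\<close> is a Kuhn--Tucker pair of the normal problem; \<open>sep\<close> says that \<open>v\<close>
  is the element of least norm in the closure of \<open>dom f - dom g\<close>.\<close>

locale shifted_Douglas_Rachford =
  fixes f g :: "'a::{real_inner, complete_space} \<Rightarrow> ereal" and v u z x :: 'a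
  assumes f: "f \<in> Gamma0" and g: "g \<in> Gamma0"
    and sep: "\<And>a b. a \<in> dom f \<Longrightarrow> b \<in> dom g \<Longrightarrow> v \<bullet> v \<le> v \<bullet> (a - b)"
    and u_f: "u \<in> subdiff f z" and u_g: "- u \<in> subdiff g (z - v)"
begin

section \<open>Iterates, subgradients and drifting multipliers\<close>

definition T :: "'a \<Rightarrow> 'a" where "T y = y - prox f y + prox g (refl f y)"
definition X :: "nat \<Rightarrow> 'a" where "X n = (T ^^ n) x"
definition p :: "nat \<Rightarrow> 'a" where "p n = prox f (X n)"
definition q :: "nat \<Rightarrow> 'a" where "q n = prox g (refl f (X n))"
definition r :: "nat \<Rightarrow> 'a" where "r n = X n - p n"
definition w :: "nat \<Rightarrow> 'a" where "w n = refl f (X n) - q n"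

text \<open>The multiplier is the fixed \<open>u\<close> of the locale for every solution, so that
  different solutions can be compared along orbits with the same drift.\<close>

definition solution :: "'a \<Rightarrow> bool" where
  "solution y \<longleftrightarrow> u \<in> subdiff f y \<and> - u \<in> subdiff g (y - v)"

text \<open>\<open>E\<close> and \<open>D\<close> are the monotonicity gaps between the iteration
  and the orbit \<open>y + u - n v\<close>. Reflecting that orbit at \<open>y\<close> gives
  \<open>y - u + n v\<close>, which is \<open>y - v\<close> plus \<open>- u + (n + 1) v\<close>;
  hence \<open>Suc n\<close> in \<open>D\<close>.\<close>

definition E :: "'a \<Rightarrow> nat \<Rightarrow> real" where
  "E y n = (r n - (u - real n *\<^sub>R v)) \<bullet> (p n - y)"
definition D :: "'a \<Rightarrow> nat \<Rightarrow> real" where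
  "D y n = (w n - (- u + real (Suc n) *\<^sub>R v)) \<bullet> (q n - (y - v))"
definition N :: "'a \<Rightarrow> nat \<Rightarrow> real" where
  "N y n = (norm (X n - (y + u - real n *\<^sub>R v)))\<^sup>2"

lemma solution_z: "solution z"
  using u_f u_g by (simp add: solution_def)

lemma r_subdiff: "r n \<in> subdiff f (p n)"
  unfolding r_def p_def by (rule prox_subdiff[OF f])

lemma w_subdiff: "w n \<in> subdiff g (q n)"
  unfolding w_def q_def by (rule prox_subdiff[OF g])

lemma p_dom: "p n \<in> dom f" and q_dom: "q n \<in> dom g"
  using subdiff_real(1) f g r_subdiff w_subdiff by blast+

lemma w_eq: "w n = p n - r n - q n"
  by (simp add: w_def refl_def r_def p_def scaleR_2)

lemma X_eq: "X n = p n + r n" "X (Suc n) = r n + q n"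
  by (simp_all add: r_def) (simp add: X_def T_def p_def q_def)

lemma solution_dom:
  assumes "solution y" shows "y \<in> dom f" "y - v \<in> dom g"
  using assms subdiff_real(1) f g unfolding solution_def by blast+

text \<open>Inserting \<open>b = y - v\<close> or \<open>a = y\<close> in \<open>sep\<close> shows
  that \<open>- v\<close> is normal to \<open>dom f\<close> at \<open>y\<close> and \<open>v\<close>
  is normal to \<open>dom g\<close> at \<open>y - v\<close>. Adding normal vectors preserves
  subgradients.\<close>

lemma drifted_multiplier:
  assumes y: "solution y" and t: "0 \<le> t"
  shows "u - t *\<^sub>R v \<in> subdiff f y" "- u + t *\<^sub>R v \<in> subdiff g (y - v)"
proof -
  note s = y[unfolded solution_def] and d = solution_dom[OF y]
  show "u - t *\<^sub>R v \<in> subdiff f y"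
  proof (rule subdiff_realI[OF f d(1)])
    fix a assume a: "a \<in> dom f"
    have "0 \<le> t * (v \<bullet> (a - y))"
      using sep[OF a d(2)] t by (simp add: inner_diff_right)
    then show "real_of_ereal (f y) + (u - t *\<^sub>R v) \<bullet> (a - y) \<le> real_of_ereal (f a)"
      using subdiff_real(2)[OF f conjunct1[OF s] a] by (simp add: inner_diff_left)
  qed
  show "- u + t *\<^sub>R v \<in> subdiff g (y - v)"
  proof (rule subdiff_realI[OF g d(2)])
    fix b assume b: "b \<in> dom g"
    have "v \<bullet> (b - (y - v)) \<le> 0"
      using sep[OF d(1) b] by (simp add: inner_diff_right)
    then have "t * (v \<bullet> (b - (y - v))) \<le> 0" using t by (simp add: mult_nonneg_nonpos)
    then show "real_of_ereal (g (y - v)) + (- u + t *\<^sub>R v) \<bullet> (b - (y - v)) \<le> real_of_ereal (g b)"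
      using subdiff_real(2)[OF g conjunct2[OF s] b] by (simp only: inner_add_left inner_scaleR_left)
  qed
qed

section \<open>Descent of the distance to a drifting orbit\<close>

lemma E_nonneg: "solution y \<Longrightarrow> 0 \<le> E y n"
  unfolding E_def by (rule subdiff_monotone[OF f r_subdiff drifted_multiplier(1)]) auto

lemma D_nonneg: "solution y \<Longrightarrow> 0 \<le> D y n"
  unfolding D_def by (rule subdiff_monotone[OF g w_subdiff drifted_multiplier(2)]) auto

lemma N_Suc: "N y n = N y (Suc n) + (norm (p n - q n - v))\<^sup>2 + 2 * E y n + 2 * D y n"
proof -
  \<comment> \<open>In these variables the claim is the identity
    \<open>|P+S|^2 = |S+Q|^2 + |P-Q|^2 + 2<S,P> + 2<P-S-Q,Q>\<close>.\<close>
  define P Q S where "P = p n - y" and "Q = q n - (y - v)" and "S = r n - (u - real n *\<^sub>R v)"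
  have 1: "X n - (y + u - real n *\<^sub>R v) = P + S"
    by (simp add: X_eq(1) P_def S_def)
  have 2: "X (Suc n) - (y + u - real (Suc n) *\<^sub>R v) = S + Q"
    by (simp add: X_eq(2) Q_def S_def algebra_simps)
  have 3: "p n - q n - v = P - Q" by (simp add: P_def Q_def)
  have 4: "w n - (- u + real (Suc n) *\<^sub>R v) = P - S - Q"
    by (simp add: w_eq P_def Q_def S_def algebra_simps)
  show ?thesis
    unfolding N_def E_def D_def 1 2 3 4 P_def[symmetric] Q_def[symmetric] S_def[symmetric]
      power2_norm_eq_inner
    by (simp add: inner_add_left inner_add_right inner_diff_left inner_diff_right inner_commute)
qed

lemma N_decseq:
  assumes "solution y" shows "decseq (N y)"
proof (rule decseq_SucI)
  show "N y (Suc n) \<le> N y n" for n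
    using N_Suc[of y n] E_nonneg[OF assms, of n] D_nonneg[OF assms, of n]
      zero_le_power2[of "norm (p n - q n - v)"] by linarith
qed

lemma N_convergent:
  assumes "solution y" shows "convergent (N y)"
proof (rule Bseq_monoseq_convergent)
  show "monoseq (N y)" using N_decseq[OF assms] by (rule decseq_imp_monoseq)
  have "norm (N y n) \<le> N y 0" for n
    using decseqD[OF N_decseq[OF assms], of 0 n] by (simp add: N_def)
  then show "Bseq (N y)" by (rule BseqI')
qed

lemma
  assumes y: "solution y"
  shows E_lim: "E y \<longlonglongrightarrow> 0" and D_lim: "D y \<longlonglongrightarrow> 0" and gap_lim: "(\<lambda>n. p n - q n) \<longlonglongrightarrow> v"
proof -
  obtain l where l: "N y \<longlonglongrightarrow> l" using N_convergent[OF y] by (auto simp: convergent_def)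
  have "(\<lambda>n. N y n - N y (Suc n)) \<longlonglongrightarrow> l - l" by (intro tendsto_diff l LIMSEQ_Suc)
  then have lim: "(\<lambda>n. N y n - N y (Suc n)) \<longlonglongrightarrow> 0" by simp
  \<comment> \<open>The three nonnegative terms in \<open>N_Suc\<close> sum to a decrement of
    \<open>N y\<close>, up to factors 2, so each is dominated by it.\<close>
  have E: "norm (E y n) \<le> N y n - N y (Suc n)" and D: "norm (D y n) \<le> N y n - N y (Suc n)"
    and G: "norm ((norm (p n - q n - v))\<^sup>2) \<le> N y n - N y (Suc n)" for n
    using N_Suc[of y n] E_nonneg[OF y, of n] D_nonneg[OF y, of n] zero_le_power2[of "norm (p n - q n - v)"]
    unfolding real_norm_def by linarith+
  show "E y \<longlonglongrightarrow> 0" by (rule Lim_null_comparison[OF always_eventually[OF allI[OF E]] lim])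
  show "D y \<longlonglongrightarrow> 0" by (rule Lim_null_comparison[OF always_eventually[OF allI[OF D]] lim])
  have "(\<lambda>n. (norm (p n - q n - v))\<^sup>2) \<longlonglongrightarrow> 0"
    by (rule Lim_null_comparison[OF always_eventually[OF allI[OF G]] lim])
  then have "(\<lambda>n. sqrt ((norm (p n - q n - v))\<^sup>2)) \<longlonglongrightarrow> sqrt 0" by (rule tendsto_real_sqrt)
  then have "(\<lambda>n. norm (p n - q n - v)) \<longlonglongrightarrow> 0" by simp
  then show "(\<lambda>n. p n - q n) \<longlonglongrightarrow> v" by (rule LIM_zero_cancel[OF tendsto_norm_zero_cancel])
qed

text \<open>\<open>X n\<close> may be unbounded, but nonnegativity of \<open>E z n\<close> allows
  the component \<open>S\<close> to be dropped from \<open>N z n\<close>.\<close>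

lemma p_bounded: "norm (p n) \<le> sqrt (N z 0) + norm z"
proof -
  have "decseq (N z)" by (rule N_decseq[OF solution_z])
  then have "N z n \<le> N z 0" by (simp add: decseqD)
  moreover have "(norm (p n - z))\<^sup>2 \<le> N z n"
  proof -
    define P S where "P = p n - z" and "S = r n - (u - real n *\<^sub>R v)"
    have eq: "X n - (z + u - real n *\<^sub>R v) = P + S" by (simp add: X_eq(1) P_def S_def)
    have "0 \<le> S \<bullet> P" using E_nonneg[OF solution_z, of n] by (simp add: E_def P_def S_def)
    moreover have "0 \<le> S \<bullet> S" by simp
    ultimately show ?thesis
      unfolding N_def eq P_def[symmetric] power2_norm_eq_inner
      by (simp add: inner_add_left inner_add_right inner_commute)
  qed
  ultimately have "norm (p n - z) \<le> sqrt (N z 0)" by (intro real_le_rsqrt) linarith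
  then show ?thesis using norm_triangle_sub[of "p n" z] by linarith
qed

section \<open>Limits of function values\<close>

lemma
  assumes y: "solution y"
  shows f_value_lim: "(\<lambda>n. real_of_ereal (f (p n)) - u \<bullet> (p n - y)) \<longlonglongrightarrow> real_of_ereal (f y)"
    and g_value_lim: "(\<lambda>n. real_of_ereal (g (q n)) + u \<bullet> (q n - (y - v))) \<longlonglongrightarrow> real_of_ereal (g (y - v))"
proof -
  note s = y[unfolded solution_def] and d = solution_dom[OF y]
  \<comment> \<open>The subgradient inequalities at \<open>y\<close> and at \<open>p n\<close> place
    this difference between 0 and \<open>E y n\<close>; the drift term, though multiplied by
    \<open>n\<close>, has the favourable sign.\<close>
  have F: "norm (real_of_ereal (f (p n)) - u \<bullet> (p n - y) - real_of_ereal (f y)) \<le> E y n" for n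
  proof -
    have "real_of_ereal (f (p n)) + r n \<bullet> (y - p n) \<le> real_of_ereal (f y)"
      by (rule subdiff_real(2)[OF f r_subdiff d(1)])
    moreover have "real_of_ereal (f y) + u \<bullet> (p n - y) \<le> real_of_ereal (f (p n))"
      by (rule subdiff_real(2)[OF f conjunct1[OF s] p_dom])
    moreover have "0 \<le> real n * (v \<bullet> (p n - y))"
      using sep[OF p_dom d(2), of n] by (simp add: inner_diff_right)
    moreover have "E y n = - (r n \<bullet> (y - p n)) - u \<bullet> (p n - y) + real n * (v \<bullet> (p n - y))"
      by (simp add: E_def inner_diff_left inner_diff_right algebra_simps)
    ultimately show ?thesis unfolding real_norm_def by linarith
  qed
  show "(\<lambda>n. real_of_ereal (f (p n)) - u \<bullet> (p n - y)) \<longlonglongrightarrow> real_of_ereal (f y)"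
    by (rule LIM_zero_cancel, rule Lim_null_comparison[OF always_eventually[OF allI[OF F]] E_lim[OF y]])
  have G: "norm (real_of_ereal (g (q n)) + u \<bullet> (q n - (y - v)) - real_of_ereal (g (y - v))) \<le> D y n" for n
  proof -
    define b where "b = q n - (y - v)"
    have "real_of_ereal (g (q n)) + w n \<bullet> (y - v - q n) \<le> real_of_ereal (g (y - v))"
      by (rule subdiff_real(2)[OF g w_subdiff d(2)])
    moreover have "w n \<bullet> (y - v - q n) = - (w n \<bullet> b)" by (simp add: b_def inner_diff_right)
    moreover have "real_of_ereal (g (y - v)) + (- u) \<bullet> b \<le> real_of_ereal (g (q n))"
      unfolding b_def by (rule subdiff_real(2)[OF g conjunct2[OF s] q_dom])
    moreover have "v \<bullet> b \<le> 0"
      using sep[OF d(1) q_dom, of n] by (simp add: b_def inner_diff_right)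
    then have "real (Suc n) * (v \<bullet> b) \<le> 0" by (intro mult_nonneg_nonpos) auto
    moreover have "D y n = w n \<bullet> b + u \<bullet> b - real (Suc n) * (v \<bullet> b)"
      unfolding D_def b_def[symmetric] inner_diff_left inner_add_left inner_minus_left inner_scaleR_left by simp
    ultimately show ?thesis unfolding real_norm_def b_def[symmetric] inner_minus_left by linarith
  qed
  show "(\<lambda>n. real_of_ereal (g (q n)) + u \<bullet> (q n - (y - v))) \<longlonglongrightarrow> real_of_ereal (g (y - v))"
    by (rule LIM_zero_cancel, rule Lim_null_comparison[OF always_eventually[OF allI[OF G]] D_lim[OF y]])
qed

section \<open>Weak cluster points of the shadow sequence\<close>

lemma q_weak_limit:
  assumes G: "G \<le> sequentially" and lim: "((\<lambda>n. p n \<bullet> b) \<longlongrightarrow> y \<bullet> b) G"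
  shows "((\<lambda>n. q n \<bullet> b) \<longlongrightarrow> (y - v) \<bullet> b) G"
proof -
  have "((\<lambda>n. p n \<bullet> b - (p n - q n) \<bullet> b) \<longlongrightarrow> y \<bullet> b - v \<bullet> b) G"
    by (intro tendsto_intros lim tendsto_mono[OF G gap_lim[OF solution_z]])
  then show ?thesis by (simp add: inner_diff_left)
qed

text \<open>Weak convergence settles the linear term left open in \<open>f_value_lim\<close> and
  \<open>g_value_lim\<close>. It is used with \<open>y = z\<close> to recognise cluster points as
  solutions, and with \<open>y' = y\<close> for the final limits.\<close>

lemma values_weak_limit:
  assumes y: "solution y" and G: "G \<le> sequentially"
    and lim: "\<And>b. ((\<lambda>n. p n \<bullet> b) \<longlongrightarrow> y' \<bullet> b) G"
  shows "((\<lambda>n. real_of_ereal (f (p n))) \<longlongrightarrow> real_of_ereal (f y) + u \<bullet> (y' - y)) G"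
    and "((\<lambda>n. real_of_ereal (g (q n))) \<longlongrightarrow> real_of_ereal (g (y - v)) + (- u) \<bullet> ((y' - v) - (y - v))) G"
proof -
  have "((\<lambda>n. (real_of_ereal (f (p n)) - u \<bullet> (p n - y)) + (p n \<bullet> u - y \<bullet> u))
      \<longlongrightarrow> real_of_ereal (f y) + (y' \<bullet> u - y \<bullet> u)) G"
    by (intro tendsto_intros lim tendsto_mono[OF G f_value_lim[OF y]])
  then show "((\<lambda>n. real_of_ereal (f (p n))) \<longlongrightarrow> real_of_ereal (f y) + u \<bullet> (y' - y)) G"
    by (simp add: inner_diff_right inner_commute)
  have "((\<lambda>n. (real_of_ereal (g (q n)) + u \<bullet> (q n - (y - v))) - (q n \<bullet> u - (y - v) \<bullet> u))
      \<longlongrightarrow> real_of_ereal (g (y - v)) - ((y' - v) \<bullet> u - (y - v) \<bullet> u)) G"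
    by (intro tendsto_diff tendsto_const q_weak_limit[OF G lim] tendsto_mono[OF G g_value_lim[OF y]])
  then show "((\<lambda>n. real_of_ereal (g (q n))) \<longlongrightarrow> real_of_ereal (g (y - v)) + (- u) \<bullet> ((y' - v) - (y - v))) G"
    by (simp add: inner_diff_right inner_commute inner_diff_left algebra_simps)
qed

text \<open>Weak lower semicontinuity turns the limits of the values into exactly the upper bounds
  that \<open>subdiff_transfer\<close> requires.\<close>

lemma weak_cluster_solution:
  assumes G: "G \<noteq> bot" "G \<le> sequentially" and lim: "\<And>b. ((\<lambda>n. p n \<bullet> b) \<longlongrightarrow> y \<bullet> b) G"
  shows "solution y"
proof -
  note val = values_weak_limit[OF solution_z G(2) lim]
  have "f y \<le> ereal (real_of_ereal (f z) + u \<bullet> (y - z))"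
    by (rule Gamma0_weak_lsc[OF f G(1) lim val(1) p_dom])
  moreover have "g (y - v) \<le> ereal (real_of_ereal (g (z - v)) + (- u) \<bullet> ((y - v) - (z - v)))"
    by (rule Gamma0_weak_lsc[OF g G(1) q_weak_limit[OF G(2) lim] val(2) q_dom])
  ultimately show ?thesis
    unfolding solution_def using subdiff_transfer[OF f u_f] subdiff_transfer[OF g u_g] by blast
qed

text \<open>Subtracting the polarisations of \<open>N y\<close> and \<open>N y'\<close>, and then \<open>E y\<close> and \<open>E y'\<close>, removes the
  unbounded part of \<open>X\<close>.\<close>

lemma inner_difference_convergent:
  assumes y: "solution y" and y': "solution y'"
  shows "convergent (\<lambda>n. p n \<bullet> (y - y'))"
proof -
  obtain l l' where l: "N y \<longlonglongrightarrow> l" "N y' \<longlonglongrightarrow> l'"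
    using N_convergent y y' unfolding convergent_def by blast
  have eq: "p n \<bullet> (y - y') = (N y' n - N y n) / 2 + (y \<bullet> y - y' \<bullet> y') / 2 - (E y' n - E y n)" for n
  proof -
    define S where "S = r n - (u - real n *\<^sub>R v)"
    have "X n - (a + u - real n *\<^sub>R v) = p n - a + S" for a by (simp add: X_eq(1) S_def)
    then have N: "N a n = (p n - a + S) \<bullet> (p n - a + S)" for a
      by (simp only: N_def power2_norm_eq_inner)
    show ?thesis
      unfolding N E_def S_def[symmetric]
      by (simp add: inner_add_left inner_add_right inner_diff_left inner_diff_right inner_commute field_simps)
  qed
  have "(\<lambda>n. p n \<bullet> (y - y')) \<longlonglongrightarrow> (l' - l) / 2 + (y \<bullet> y - y' \<bullet> y') / 2 - (0 - 0)"
    unfolding eq by (intro tendsto_intros l E_lim y y') auto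
  then show ?thesis by (auto simp: convergent_def)
qed

lemma weak_cluster_unique:
  assumes G: "G \<noteq> bot" "G \<le> sequentially" and lim: "\<And>b. ((\<lambda>n. p n \<bullet> b) \<longlongrightarrow> y \<bullet> b) G"
    and G': "G' \<noteq> bot" "G' \<le> sequentially" and lim': "\<And>b. ((\<lambda>n. p n \<bullet> b) \<longlongrightarrow> y' \<bullet> b) G'"
  shows "y = y'"
proof -
  obtain c where c: "(\<lambda>n. p n \<bullet> (y - y')) \<longlonglongrightarrow> c"
    using inner_difference_convergent weak_cluster_solution[OF G lim] weak_cluster_solution[OF G' lim']
    unfolding convergent_def by blast
  have "y \<bullet> (y - y') = c" by (rule tendsto_unique[OF G(1) lim tendsto_mono[OF G(2) c]])
  moreover have "y' \<bullet> (y - y') = c" by (rule tendsto_unique[OF G'(1) lim' tendsto_mono[OF G'(2) c]])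
  ultimately have "(y - y') \<bullet> (y - y') = 0" by (simp add: inner_diff_left)
  then show ?thesis by simp
qed

lemma p_weak_convergent: obtains y where "solution y" "weak_conv p y"
proof -
  obtain y G where G: "G \<noteq> bot" "G \<le> sequentially" and lim: "\<And>b. ((\<lambda>n. p n \<bullet> b) \<longlongrightarrow> y \<bullet> b) G"
    using bounded_weak_cluster[of p _ sequentially] p_bounded trivial_limit_sequentially by metis
  have "(\<lambda>n. p n \<bullet> b) \<longlonglongrightarrow> y \<bullet> b" for b
  proof (rule ccontr)
    assume "\<not> ?thesis"
    then obtain e where e: "e > 0" "\<not> eventually (\<lambda>n. dist (p n \<bullet> b) (y \<bullet> b) < e) sequentially"
      unfolding tendsto_iff by blast
    \<comment> \<open>Restricting to the indices where convergence against \<open>b\<close> fails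
      gives a proper filter. A cluster point along it must again be \<open>y\<close>, a
      contradiction.\<close>
    define F where "F = inf sequentially (principal {n. \<not> dist (p n \<bullet> b) (y \<bullet> b) < e})"
    have "F \<noteq> bot"
      using e(2) unfolding F_def trivial_limit_def eventually_inf_principal by simp
    then obtain y' G' where G': "G' \<noteq> bot" "G' \<le> F" and lim': "\<And>b. ((\<lambda>n. p n \<bullet> b) \<longlongrightarrow> y' \<bullet> b) G'"
      using bounded_weak_cluster[of p _ F] p_bounded by metis
    have "G' \<le> sequentially" using G'(2) by (simp add: F_def)
    then have "y' = y" using weak_cluster_unique[OF G'(1) _ lim' G lim] by simp
    then have "eventually (\<lambda>n. dist (p n \<bullet> b) (y \<bullet> b) < e) G'"
      using lim'[of b] e(1) unfolding tendsto_iff by blast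
    moreover have "eventually (\<lambda>n. \<not> dist (p n \<bullet> b) (y \<bullet> b) < e) G'"
      by (rule filter_leD[OF G'(2)]) (simp add: F_def eventually_inf_principal)
    ultimately have "eventually (\<lambda>n. False) G'" by eventually_elim simp
    with G'(1) show False by simp
  qed
  with weak_cluster_solution[OF G lim] show thesis using that unfolding weak_conv_def by blast
qed

text \<open>In the sum of the two subgradient inequalities the slopes \<open>u\<close> and
  \<open>- u\<close> cancel.\<close>

lemma solution_minimizes:
  assumes y: "solution y" shows "f y + g (y - v) \<le> f a + g (a - v)"
proof (cases "a \<in> dom f \<and> a - v \<in> dom g")
  case True
  note s = y[unfolded solution_def] and d = solution_dom[OF y]
  have "real_of_ereal (f y) + real_of_ereal (g (y - v)) \<le> real_of_ereal (f a) + real_of_ereal (g (a - v))"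
    using subdiff_real(2)[OF f conjunct1[OF s] conjunct1[OF True]]
      subdiff_real(2)[OF g conjunct2[OF s] conjunct2[OF True]]
    by (simp add: inner_diff_right)
  then show ?thesis
    using True d by (metis Gamma0_dom_ereal f g ereal_less_eq(3) plus_ereal.simps(1))
next
  case False
  moreover have "f a \<noteq> -\<infinity>" "g (a - v) \<noteq> -\<infinity>" using f g by (auto simp: Gamma0_def proper_def)
  ultimately have "f a + g (a - v) = \<infinity>" by (cases "f a"; cases "g (a - v)") (auto simp: dom_def)
  then show ?thesis by (simp only: ereal_less_eq(1))
qed

lemma Douglas_Rachford_convergence:
  obtains y where "weak_conv p y" "weak_conv q (y - v)"
    "\<And>a. f y + g (y - v) \<le> f a + g (a - v)"
    "(\<lambda>n. f (p n)) \<longlonglongrightarrow> f y" "(\<lambda>n. g (q n)) \<longlonglongrightarrow> g (y - v)"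
    "(\<lambda>n. f (p n) + g (q n)) \<longlonglongrightarrow> f y + g (y - v)"
proof -
  obtain y where y: "solution y" and lim: "weak_conv p y" by (rule p_weak_convergent)
  note lim' = lim[unfolded weak_conv_def, rule_format]
  have qlim: "weak_conv q (y - v)"
    unfolding weak_conv_def using q_weak_limit[OF order_refl lim'] by blast
  have F: "(\<lambda>n. real_of_ereal (f (p n))) \<longlonglongrightarrow> real_of_ereal (f y)"
    using values_weak_limit(1)[OF y order_refl lim'] by simp
  have G: "(\<lambda>n. real_of_ereal (g (q n))) \<longlonglongrightarrow> real_of_ereal (g (y - v))"
    using values_weak_limit(2)[OF y order_refl lim'] by simp
  have fe: "f (p n) = ereal (real_of_ereal (f (p n)))" "g (q n) = ereal (real_of_ereal (g (q n)))" for n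
    by (rule Gamma0_dom_ereal[OF f p_dom] Gamma0_dom_ereal[OF g q_dom])+
  have ye: "f y = ereal (real_of_ereal (f y))" "g (y - v) = ereal (real_of_ereal (g (y - v)))"
    by (rule Gamma0_dom_ereal[OF f] Gamma0_dom_ereal[OF g]; rule solution_dom[OF y])+
  have f': "(\<lambda>n. f (p n)) \<longlonglongrightarrow> f y" by (subst fe, subst ye, rule tendsto_ereal[OF F])
  have g': "(\<lambda>n. g (q n)) \<longlonglongrightarrow> g (y - v)" by (subst fe, subst ye, rule tendsto_ereal[OF G])
  have "(\<lambda>n. f (p n) + g (q n)) \<longlonglongrightarrow> f y + g (y - v)"
    by (subst fe(1), subst fe(2), subst ye(1), subst ye(2), unfold plus_ereal.simps(1),
        rule tendsto_ereal[OF tendsto_add[OF F G]])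
  then show thesis using that[OF lim qlim solution_minimizes[OF y] f' g'] by blast
qed

end

section \<open>Identification of the displacement vector\<close>

lemma dom_conj_add:
  assumes f: "f \<in> Gamma0" and w: "w \<in> dom (conj f)" and K: "\<And>b. b \<in> dom f \<Longrightarrow> s \<bullet> b \<le> K"
  shows "w + s \<in> dom (conj f)"
proof -
  obtain M where M: "conj f w < ereal M" using w unfolding dom_def by (metis ereal_dense2 mem_Collect_eq)
  have "ereal ((w + s) \<bullet> y) - f y \<le> ereal (M + K)" for y
  proof (cases "y \<in> dom f")
    case True
    have "ereal (w \<bullet> y) - f y \<le> ereal M"
      using M unfolding conj_def by (meson SUP_upper UNIV_I less_imp_le order_trans)
    with K[OF True] show ?thesis
      by (rule_tac Gamma0_dom_cases[OF f True]) (simp add: inner_add_left)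
  next
    case False
    then show ?thesis by (simp add: dom_def)
  qed
  then have "conj f (w + s) \<le> ereal (M + K)" unfolding conj_def by (rule SUP_least)
  then show ?thesis by (auto simp: dom_def)
qed

lemma minimal_displacement_separates:
  fixes f g :: "'a::{real_inner, complete_space} \<Rightarrow> ereal"
  assumes f: "f \<in> Gamma0" and g: "g \<in> Gamma0"
    and D: "D = {a - b | a b. a \<in> dom_subdiff f \<and> b \<in> dom_subdiff g}"
    and R: "R = {a + b | a b. a \<in> ran_subdiff f \<and> b \<in> ran_subdiff g}"
    and conj: "0 \<in> {a + b | a b. a \<in> dom (conj f) \<and> b \<in> dom (conj g)}"
    and ab: "a \<in> dom f" "b \<in> dom g"
  defines "v \<equiv> proj (closure D \<inter> closure R) 0"
  shows "v \<bullet> v \<le> v \<bullet> (a - b)"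
proof -
  \<comment> \<open>The full domains are used because they are convex, so that \<open>A\<close> has
    a projection; density of the subdifferential domains gives \<open>A = closure D\<close>.\<close>
  define A where "A = closure {a - b | a b. a \<in> dom f \<and> b \<in> dom g}"
  have diff: "{a - b | a b. a \<in> S \<and> b \<in> S'} = (\<Union>x\<in>S. \<Union>y\<in>S'. {x - y})" for S S' :: "'a set" by auto
  have "convex {a - b | a b. a \<in> dom f \<and> b \<in> dom g}"
    unfolding diff by (rule convex_differences[OF convex_dom[OF f] convex_dom[OF g]])
  then have cA: "convex A" "closed A" "A \<noteq> {}"
    using ab unfolding A_def by (auto intro: convex_closure)
  obtain d where d: "d \<in> A" "\<And>y. y \<in> A \<Longrightarrow> (0 - d) \<bullet> (y - d) \<le> 0"
    by (rule projection_exists[OF cA, of 0]) (rule that)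
  have sep: "d \<bullet> d \<le> d \<bullet> (a - b)" if "a \<in> dom f" "b \<in> dom g" for a b
  proof -
    have "a - b \<in> A" unfolding A_def using that by (intro subsetD[OF closure_subset]) blast
    from d(2)[OF this] show ?thesis by (simp add: inner_diff_right)
  qed
  have lim_diff: "x - y \<in> closure D" if "x \<in> closure (dom_subdiff f)" "y \<in> closure (dom_subdiff g)" for x y
  proof -
    obtain s t where "\<And>n. s n \<in> dom_subdiff f" "s \<longlonglongrightarrow> x" "\<And>n. t n \<in> dom_subdiff g" "t \<longlonglongrightarrow> y"
      using \<open>x \<in> _\<close> \<open>y \<in> _\<close> unfolding closure_sequential by blast
    then show ?thesis unfolding closure_sequential D
      by (intro exI[of _ "\<lambda>n. s n - t n"]) (auto intro: tendsto_diff)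
  qed
  have lim_sum: "x + y \<in> closure R" if "x \<in> closure (ran_subdiff f)" "y \<in> closure (ran_subdiff g)" for x y
  proof -
    obtain s t where "\<And>n. s n \<in> ran_subdiff f" "s \<longlonglongrightarrow> x" "\<And>n. t n \<in> ran_subdiff g" "t \<longlonglongrightarrow> y"
      using \<open>x \<in> _\<close> \<open>y \<in> _\<close> unfolding closure_sequential by blast
    then show ?thesis unfolding closure_sequential R
      by (intro exI[of _ "\<lambda>n. s n + t n"]) (auto intro: tendsto_add)
  qed
  have "dom_subdiff h \<subseteq> dom h" for h :: "'a \<Rightarrow> ereal"
    by (auto simp: dom_subdiff_def subdiff_def dom_def)
  then have DA: "closure D \<subseteq> A" unfolding D A_def by (intro closure_mono) blast
  have "{a - b | a b. a \<in> dom f \<and> b \<in> dom g} \<subseteq> closure D"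
    using lim_diff dom_subset_closure_dom_subdiff[OF f] dom_subset_closure_dom_subdiff[OF g] by blast
  then have "A \<subseteq> closure D" unfolding A_def by (rule closure_minimal) simp
  then have dD: "d \<in> closure D" using d(1) by blast
  obtain s w where sw: "s \<in> dom (conj f)" "w \<in> dom (conj g)" "0 = s + w" using conj by blast
  \<comment> \<open>Separation at the fixed \<open>a\<close> bounds \<open>d\<close> from above on
    \<open>dom g\<close>, so \<open>w\<close> can be shifted by \<open>d\<close> inside
    \<open>dom (conj g)\<close>. Since \<open>s + w = 0\<close>, this puts \<open>d\<close> in
    \<open>closure R\<close>.\<close>
  have "d \<bullet> b' \<le> d \<bullet> a - d \<bullet> d" if "b' \<in> dom g" for b'
    using sep[OF ab(1) that] by (simp add: inner_diff_right)
  then have "w + d \<in> dom (conj g)" by (rule dom_conj_add[OF g sw(2)])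
  then have "s + (w + d) \<in> closure R"
    using lim_sum sw(1) dom_conj_subset_closure_ran_subdiff[OF f] dom_conj_subset_closure_ran_subdiff[OF g]
    by blast
  then have dR: "d \<in> closure R" using sw(3) by (simp add: add.assoc[symmetric])
  \<comment> \<open>\<open>d\<close> is nearest to 0 in all of \<open>A\<close> and lies in the
    smaller set \<open>closure D \<inter> closure R\<close>, so it is the projection onto that set
    too.\<close>
  have "v = d"
    unfolding v_def by (rule proj_eq) (use dD dR d(2) DA in blast)+
  with sep[OF ab] show ?thesis by simp
qed

theorem theorem6p9:
  fixes f g :: "'a::{real_inner, complete_space} \<Rightarrow> ereal"
    and T :: "'a \<Rightarrow> 'a" and v x :: 'a and D R :: "'a set" and \<mu> :: ereal
  assumes fG: "f \<in> Gamma0" and gG: "g \<in> Gamma0"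
    and T_def: "T = (\<lambda>y. y - prox f y + prox g (refl f y))"
    and v_def: "v = proj (closure (range (\<lambda>y. y - T y))) 0"
    and D_def: "D = {a - b | a b. a \<in> dom_subdiff f \<and> b \<in> dom_subdiff g}"
    and R_def: "R = {a + b | a b. a \<in> ran_subdiff f \<and> b \<in> ran_subdiff g}"
    and ranD: "closure (range (\<lambda>y. y - T y)) = closure (D \<inter> R)"
    and DR: "closure (D \<inter> R) = closure D \<inter> closure R"
    and dom_conj: "0 \<in> {a + b | a b. a \<in> dom (conj f) \<and> b \<in> dom (conj g)}"
    and v_ran: "v \<in> range (\<lambda>y. y - T y)"
    and zer: "{y. \<exists>u \<in> subdiff f y. \<exists>w \<in> subdiff g (y - v). u + w = 0} \<noteq> {}"
    and mu_def: "\<mu> = (INF y. f y + g (y - v))"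
  shows "\<exists>zb.
     (weak_conv (\<lambda>n. prox f ((T ^^ n) x)) zb \<and> (\<forall>y. f zb + g (zb - v) \<le> f y + g (y - v))) \<and>
     (weak_conv (\<lambda>n. prox g (refl f ((T ^^ n) x))) (zb - v) \<and>
        (\<forall>y. f ((zb - v) + v) + g (zb - v) \<le> f (y + v) + g y)) \<and>
     ((\<lambda>n. f (prox f ((T ^^ n) x)) + g (prox g (refl f ((T ^^ n) x))))
        \<longlonglongrightarrow> f zb + g (zb - v) \<and> f zb + g (zb - v) = \<mu>) \<and>
     ((\<lambda>n. f (prox f ((T ^^ n) x))) \<longlonglongrightarrow> f zb) \<and>
     ((\<lambda>n. g (prox g (refl f ((T ^^ n) x)))) \<longlonglongrightarrow> g (zb - v))"
proof -
  obtain z u w where zu: "u \<in> subdiff f z" "w \<in> subdiff g (z - v)" "u + w = 0" using zer by blast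
  then have w: "- u \<in> subdiff g (z - v)" by (simp add: add_eq_0_iff)
  have v: "v = proj (closure D \<inter> closure R) 0" using v_def ranD DR by simp
  interpret S: shifted_Douglas_Rachford f g v u z x
    using fG gG minimal_displacement_separates[OF fG gG D_def R_def dom_conj] zu(1) w
    by unfold_locales (auto simp: v)
  have T: "S.T = T" by (simp add: T_def S.T_def fun_eq_iff)
  have p: "S.p = (\<lambda>n. prox f ((T ^^ n) x))" and q: "S.q = (\<lambda>n. prox g (refl f ((T ^^ n) x)))"
    by (simp_all add: S.p_def S.q_def S.X_def T fun_eq_iff)
  obtain y where y: "weak_conv S.p y" "weak_conv S.q (y - v)"
    "\<And>a. f y + g (y - v) \<le> f a + g (a - v)"
    "(\<lambda>n. f (S.p n)) \<longlonglongrightarrow> f y" "(\<lambda>n. g (S.q n)) \<longlonglongrightarrow> g (y - v)"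
    "(\<lambda>n. f (S.p n) + g (S.q n)) \<longlonglongrightarrow> f y + g (y - v)"
    by (rule S.Douglas_Rachford_convergence) (rule that)
  have "f y + g (y - v) = \<mu>"
    unfolding mu_def by (rule antisym) (auto intro: INF_greatest INF_lower y(3))
  \<comment> \<open>The translation by \<open>v\<close> carries one minimisation problem into the
    other.\<close>
  moreover have "f ((y - v) + v) + g (y - v) \<le> f (a + v) + g a" for a
    using y(3)[of "a + v"] by simp
  ultimately show ?thesis using y unfolding p q by blast
qed

end
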